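(* For every fixed pair of functions $f,g\in\mathcal{L}^n$, there exists a pair $(T_0,z_0)\in \mathrm{SL}_n(\mathbb{R})\times\mathbb{R}^n$ such that $$P_{f,g}(T_0,z_0)=\sup\{P_{f,g}(T,z):(T,z)\in \mathrm{SL}_n(\mathbb{R})\times\mathbb{R}^n\},\qquad P_{f,g}(T,z):=\int_{\mathbb{R}^n}f(x)\,g(T^{-1}(x-z))\,dx.$$
   Context: $n\ge1$. $\mathcal{L}^n$ is the class of functions $f=e^{-\psi}:\mathbb{R}^n\to[0,\infty)$ (convention $e^{-\infty}=0$) where $\psi:\mathbb{R}^n\to\mathbb{R}\cup\{\infty\}$ is convex, proper (finite somewhere), coercive ($\lim_{|x|\to\infty}\psi(x)=\infty$) and lower semicontinuous. *)

theory Defs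
  imports "HOL-Analysis.Analysis"
begin

text \<open>
  Restricting to \<open>0 < t < 1\<close> keeps the products \<open>0 * \<infinity>\<close> out of the convexity inequality; the
  endpoints \<open>t = 0\<close> and \<open>t = 1\<close> carry no information. The definition is meant for functions that
  do not take the value \<open>- \<infinity>\<close>.
\<close>

definition ereal_convex :: "('a::real_vector \<Rightarrow> ereal) \<Rightarrow> bool" where
  "ereal_convex \<psi> \<longleftrightarrow>
     (\<forall>x y. \<forall>t::real. 0 < t \<and> t < 1 \<longrightarrow>
        \<psi> ((1 - t) *\<^sub>R x + t *\<^sub>R y) \<le> ereal (1 - t) * \<psi> x + ereal t * \<psi> y)"

definition lower_semicont :: "('a::topological_space \<Rightarrow> ereal) \<Rightarrow> bool" where
  "lower_semicont \<psi> \<longleftrightarrow> (\<forall>x. \<psi> x \<le> Liminf (at x) \<psi>)"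

definition exp_neg :: "ereal \<Rightarrow> real" where
  "exp_neg a = (if a = \<infinity> then 0 else exp (- real_of_ereal a))"

text \<open>
  The dimension is \<open>CARD('n)\<close>, hence at least 1. The functions \<open>\<psi>\<close> range over maps into
  \<open>\<real> \<union> {\<infinity>}\<close>, that is, extended real functions that omit \<open>- \<infinity>\<close>.
\<close>

definition log_concave_class :: "(real ^ 'n \<Rightarrow> real) set" where
  "log_concave_class =
     {f. \<exists>\<psi> :: real ^ 'n \<Rightarrow> ereal.
           (\<forall>x. \<psi> x \<noteq> - \<infinity>) \<and>
           ereal_convex \<psi> \<and>
           (\<exists>x. \<psi> x \<noteq> \<infinity>) \<and>
           (\<psi> \<longlongrightarrow> \<infinity>) at_infinity \<and>
           lower_semicont \<psi> \<and>
           (\<forall>x. f x = exp_neg (\<psi> x))}"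

definition SL :: "(real ^ 'n ^ 'n) set" where
  "SL = {T. det T = 1}"

text \<open>
  The integrand is nonnegative, so the integral is taken in \<open>[0, \<infinity>]\<close>. This way neither the
  integral nor its supremum depends on a default value for a non-integrable function or an
  unbounded set.
\<close>

definition P :: "(real ^ 'n \<Rightarrow> real) \<Rightarrow> (real ^ 'n \<Rightarrow> real) \<Rightarrow> real ^ 'n ^ 'n \<Rightarrow> real ^ 'n \<Rightarrow> ennreal"
  where "P f g T z = (\<integral>\<^sup>+ x. ennreal (f x * g (matrix_inv T *v (x - z))) \<partial>lborel)"

end

theory Submission
  imports Defs
begin

text \<open>
  Put \<open>S = T\<inverse>\<close> and \<open>w = T\<inverse> z\<close>. This is a bijection of
  \<open>SL \<times> UNIV\<close> onto itself (\<open>image_matrix_inv_SL\<close>), and it turns the functional into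
  \<open>\<integral> f(x) g(S x - w) dx\<close>, called \<open>overlap f g (S, w)\<close> below. The new parameters enter linearly,
  so the functional makes sense on the whole vector space of pairs \<open>(S, w)\<close>, and \<open>SL \<times> UNIV\<close> is a
  closed subset of that space. The maximum then exists for the following two reasons.

  The overlap is upper semicontinuous (\<open>limsup_overlap_le\<close>). Indeed \<open>g\<close> is upper semicontinuous
  and bounded by some \<open>M\<close>, and \<open>M f\<close> is an integrable majorant, so the reverse Fatou lemma applies.

  The overlap tends to \<open>0\<close> as \<open>(S, w)\<close> goes to infinity (\<open>overlap_vanishes_at_infinity\<close>). By
  compactness of the unit sphere it suffices to consider a sequence \<open>(S\<^sub>k, w\<^sub>k)\<close> whose directions
  converge to a unit vector \<open>(S', w')\<close>. The points \<open>x\<close> with \<open>S' x = w'\<close> lie in a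
  hyperplane or do not exist at all, so they form a null set (\<open>AE_affine_nonzero\<close>). For all other \<open>x\<close> the
  vectors \<open>S\<^sub>k x - w\<^sub>k\<close> go to infinity, whence \<open>g (S\<^sub>k x - w\<^sub>k)\<close> tends to \<open>0\<close>, and dominated
  convergence with the same majorant finishes the argument.

  Hence a maximizing sequence is bounded unless the supremum is \<open>0\<close>, and any limit point of it is
  a maximizer (\<open>overlap_attains_sup\<close>). Convexity and coercivity enter only through the bound
  \<open>f x \<le> C e\<^bsup>-c|x|\<^esup>\<close> (\<open>log_concave_class_exp_decay\<close>), which yields the integrability of \<open>f\<close> and
  the decay of \<open>g\<close>.
\<close>

section \<open>Upper semicontinuous functions\<close>

text \<open>
  Unlike in a formulation with a limsup over punctured neighbourhoods, \<open>nhds x\<close> contains \<open>x\<close>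
  itself. It can therefore be composed with any sequence converging to \<open>x\<close>, including one that
  takes the value \<open>x\<close>.
\<close>

definition upper_semicont :: "('a::topological_space \<Rightarrow> real) \<Rightarrow> bool" where
  "upper_semicont f \<longleftrightarrow> (\<forall>x c. f x < c \<longrightarrow> (\<forall>\<^sub>F y in nhds x. f y < c))"

lemma upper_semicont_open_sublevel:
  assumes "upper_semicont f"
  shows "open {x. f x < c}"
proof (subst open_subopen, intro ballI)
  fix x assume "x \<in> {x. f x < c}"
  then have "\<forall>\<^sub>F y in nhds x. f y < c"
    using assms by (simp add: upper_semicont_def)
  then obtain U where "open U" "x \<in> U" "\<forall>y\<in>U. f y < c"
    unfolding eventually_nhds by blast
  then show "\<exists>T. open T \<and> x \<in> T \<and> T \<subseteq> {x. f x < c}" by blast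
qed

lemma upper_semicont_borel_measurable:
  assumes "upper_semicont f"
  shows "f \<in> borel_measurable borel"
  by (rule borel_measurableI_less) (simp add: upper_semicont_open_sublevel[OF assms])

text \<open>The sublevel sets \<open>{f < m}\<close> form an open cover of \<open>K\<close>, and finitely many of them suffice.\<close>

lemma upper_semicont_bdd_above_compact:
  assumes "upper_semicont f" "compact K"
  obtains M where "0 \<le> M" "\<And>x. x \<in> K \<Longrightarrow> f x \<le> M"
proof -
  have op: "open {x. f x < real m}" for m
    by (rule upper_semicont_open_sublevel[OF assms(1)])
  have "K \<subseteq> (\<Union>m. {x. f x < real m})"
    using reals_Archimedean2 by auto
  then obtain C where C: "finite C" "K \<subseteq> (\<Union>m\<in>C. {x. f x < real m})"
    using compactE_image[OF assms(2), of UNIV "\<lambda>m. {x. f x < real m}"] op by auto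
  \<comment> \<open>The sum serves as an upper bound of \<open>C\<close> that is nonnegative even if \<open>C\<close> is empty.\<close>
  show ?thesis
  proof (rule that[of "\<Sum>m\<in>C. real m"])
    fix x assume "x \<in> K"
    then obtain m where "m \<in> C" "f x < real m" using C by auto
    then show "f x \<le> (\<Sum>m\<in>C. real m)"
      using member_le_sum[of m C real] C by auto
  qed (simp add: sum_nonneg)
qed

text \<open>
  The pointwise inequality needed after the reverse Fatou lemma; the constant \<open>c\<close> will be the value
  of the other factor of the integrand.
\<close>

lemma upper_semicont_limsup:
  assumes "upper_semicont f" "X \<longlonglongrightarrow> x" "0 \<le> c" "\<And>y. 0 \<le> f y"
  shows "limsup (\<lambda>k. ennreal (c * f (X k))) \<le> ennreal (c * f x)"
  unfolding Limsup_le_iff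
proof (intro allI impI)
  fix y assume y: "ennreal (c * f x) < y"
  show "\<forall>\<^sub>F k in sequentially. ennreal (c * f (X k)) < y"
  proof (cases "c = 0 \<or> y = top")
    case True
    then show ?thesis using y by auto
  next
    case False
    then obtain d where d: "y = ennreal d" "0 \<le> d" by (cases y) auto
    have "c * f x < d" using y d assms by (simp add: ennreal_less_iff)
    then have "f x < d / c" using False assms(3) by (simp add: field_simps)
    then have "\<forall>\<^sub>F y in nhds x. f y < d / c" using assms(1) by (auto simp: upper_semicont_def)
    then have "\<forall>\<^sub>F k in sequentially. f (X k) < d / c"
      by (rule eventually_compose_filterlim[OF _ assms(2)])
    then show ?thesis
    proof eventually_elim
      case (elim k)
      then have "c * f (X k) < d" using False assms(3) by (simp add: field_simps)
      then show ?case using d assms by (simp add: ennreal_less_iff)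
    qed
  qed
qed

section \<open>Exponential decay of coercive log-concave functions\<close>

text \<open>
  On the shell \<open>k \<le> |x| \<le> k + 1\<close> the integrand is at most \<open>e\<^bsup>-ck\<^esup>\<close>, so the integral is bounded by
  the series of \<open>e\<^bsup>-ck\<^esup>\<close> times the volume of a ball of radius \<open>k + 1\<close>. That volume grows
  polynomially, hence is absorbed by half of the exponential, which leaves a geometric series.
\<close>

lemma nn_integral_exp_neg_norm_finite:
  assumes c: "0 < c"
  shows "(\<integral>\<^sup>+x. ennreal (exp (- c * norm (x::'a::euclidean_space))) \<partial>lborel) < \<infinity>"
proof -
  let ?n = "DIM('a)" and ?V = "unit_ball_vol (DIM('a))"
  let ?a = "\<lambda>k::nat. exp (- c * real k) * (?V * (real k + 1) ^ ?n)"
  have V: "0 \<le> ?V" by simp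
  have "summable ?a"
  proof (rule summable_comparison_test')
    show "summable (\<lambda>k. (?V * (2 * ?n / c) ^ ?n * exp (c / 2)) * exp (- c / 2) ^ k)"
      using c by (intro summable_mult summable_geometric) auto
    fix k :: nat
    \<comment> \<open>The polynomial growth is controlled by \<open>(1 + x / n)\<^sup>n \<le> e\<^sup>x\<close> at half the rate of decay.\<close>
    let ?x = "c * (real k + 1) / 2"
    have "(?x / ?n) ^ ?n \<le> (1 + ?x / ?n) ^ ?n"
      using c by (intro power_mono) auto
    also have "\<dots> \<le> exp ?x"
      using c by (intro exp_ge_one_plus_x_over_n_power_n) (auto intro: order_trans[of _ 0])
    finally have "(2 * ?n / c) ^ ?n * (?x / ?n) ^ ?n \<le> (2 * ?n / c) ^ ?n * exp ?x"
      using c by (intro mult_left_mono) auto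
    moreover have "(2 * ?n / c) ^ ?n * (?x / ?n) ^ ?n = (real k + 1) ^ ?n"
      using c by (simp flip: power_mult_distrib)
    ultimately have "(real k + 1) ^ ?n \<le> (2 * ?n / c) ^ ?n * exp ?x" by simp
    then have "?a k \<le> exp (- c * real k) * (?V * ((2 * ?n / c) ^ ?n * exp ?x))"
      using V by (intro mult_left_mono) auto
    also have "\<dots> = ?V * (2 * ?n / c) ^ ?n * (exp (- c * real k) * exp ?x)"
      by (simp add: mult_ac)
    also have "exp (- c * real k) * exp ?x = exp (c / 2) * exp (- c / 2) ^ k"
      by (simp add: field_simps flip: exp_add exp_of_nat_mult)
    finally show "norm (?a k) \<le> (?V * (2 * ?n / c) ^ ?n * exp (c / 2)) * exp (- c / 2) ^ k"
      using V by (simp add: mult_ac)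
  qed
  then have fin: "(\<Sum>k. ennreal (?a k)) \<noteq> top"
    using V by (intro ennreal_suminf_neq_top) auto
  have "(\<integral>\<^sup>+x. ennreal (exp (- c * norm (x::'a))) \<partial>lborel)
      \<le> (\<integral>\<^sup>+x. (\<Sum>k. ennreal (exp (- c * real k)) * indicator (cball 0 (real k + 1)) (x::'a)) \<partial>lborel)"
  proof (rule nn_integral_mono)
    fix x :: 'a
    let ?g = "\<lambda>k. ennreal (exp (- c * real k)) * indicator (cball 0 (real k + 1)) x"
    define k where "k = nat \<lfloor>norm x\<rfloor>"
    have "real k \<le> norm x" "norm x \<le> real k + 1"
      by (auto simp: k_def intro: less_imp_le)
    then have "ennreal (exp (- c * norm x)) \<le> sum ?g {k}"
      using c by (auto intro!: ennreal_leI)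
    also have "\<dots> \<le> (\<Sum>k. ?g k)" by (rule sum_le_suminf) auto
    finally show "ennreal (exp (- c * norm x)) \<le> (\<Sum>k. ?g k)" .
  qed
  also have "\<dots> = (\<Sum>k. \<integral>\<^sup>+x. ennreal (exp (- c * real k)) * indicator (cball 0 (real k + 1)) (x::'a) \<partial>lborel)"
  proof (rule nn_integral_suminf)
    have [measurable]: "cball (0::'a) t \<in> sets borel" for t by simp
    show "(\<lambda>x. ennreal (exp (- c * real k)) * indicator (cball 0 (real k + 1)) (x::'a))
        \<in> borel_measurable lborel" for k
      by measurable
  qed
  also have "\<dots> = (\<Sum>k. ennreal (?a k))"
  proof (rule suminf_cong)
    fix k
    have "(\<integral>\<^sup>+x. ennreal (exp (- c * real k)) * indicator (cball 0 (real k + 1)) (x::'a) \<partial>lborel)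
        = ennreal (exp (- c * real k)) * emeasure lborel (cball (0::'a) (real k + 1))"
      by (rule nn_integral_cmult_indicator) simp
    also have "emeasure lborel (cball (0::'a) (real k + 1)) = ennreal (?V * (real k + 1) ^ ?n)"
      by (rule emeasure_cball) simp
    finally show "(\<integral>\<^sup>+x. ennreal (exp (- c * real k)) * indicator (cball 0 (real k + 1)) (x::'a) \<partial>lborel)
        = ennreal (?a k)"
      using V by (simp add: ennreal_mult)
  qed
  also have "\<dots> < \<infinity>" using fin by (simp add: top.not_eq_extremum)
  finally show ?thesis .
qed

lemma exp_neg_nonneg: "0 \<le> exp_neg a"
  by (simp add: exp_neg_def)

lemma exp_neg_less:
  assumes "ereal (- ln c) < a" "0 < c"
  shows "exp_neg a < c"
proof (cases a)
  case (real r)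
  then have "- r < ln c" using assms by simp
  then have "exp (- r) < exp (ln c)" by (simp only: exp_less_mono)
  then show ?thesis using real assms by (simp add: exp_neg_def)
qed (use assms in \<open>auto simp: exp_neg_def\<close>)

lemma less_of_exp_neg:
  assumes "exp_neg a < c" "a \<noteq> - \<infinity>"
  shows "ereal (- ln c) < a"
proof (cases a)
  case (real r)
  then have "exp (- r) < c" using assms by (simp add: exp_neg_def)
  then have "- r < ln c" by (metis exp_gt_zero ln_exp ln_less_cancel_iff order_less_trans)
  then show ?thesis using real by simp
qed (use assms in auto)

lemma upper_semicont_exp_neg:
  assumes "lower_semicont \<psi>" "\<And>x. \<psi> x \<noteq> - \<infinity>"
  shows "upper_semicont (\<lambda>x. exp_neg (\<psi> x))"
  unfolding upper_semicont_def
proof (intro allI impI)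
  fix x c assume less: "exp_neg (\<psi> x) < c"
  then have c: "0 < c" using exp_neg_nonneg order_le_less_trans by blast
  have "ereal (- ln c) < \<psi> x" using less_of_exp_neg[OF less] assms by blast
  then have "\<forall>\<^sub>F y in at x. ereal (- ln c) < \<psi> y"
    using assms(1) by (auto simp: lower_semicont_def le_Liminf_iff)
  then have "\<forall>\<^sub>F y in at x. exp_neg (\<psi> y) < c"
    by eventually_elim (use c in \<open>auto intro: exp_neg_less\<close>)
  then show "\<forall>\<^sub>F y in nhds x. exp_neg (\<psi> y) < c"
    using less by (simp add: eventually_nhds_conv_at)
qed

lemma log_concave_class_nonneg: "f \<in> log_concave_class \<Longrightarrow> 0 \<le> f x"
  by (auto simp: log_concave_class_def exp_neg_nonneg)

lemma log_concave_class_upper_semicont: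
  assumes "f \<in> log_concave_class"
  shows "upper_semicont f"
proof -
  obtain \<psi> where "\<forall>x. \<psi> x \<noteq> - \<infinity>" "lower_semicont \<psi>" "\<forall>x. f x = exp_neg (\<psi> x)"
    using assms unfolding log_concave_class_def by blast
  moreover from this have "f = (\<lambda>x. exp_neg (\<psi> x))" by auto
  ultimately show ?thesis using upper_semicont_exp_neg by blast
qed

text \<open>
  Coercivity gives a radius \<open>r\<close> with \<open>\<psi> > a + 1\<close> on the sphere of radius \<open>r\<close> about \<open>x0\<close>. Along
  every ray from \<open>x0\<close> the function thus gains at least \<open>1\<close> over the distance \<open>r\<close>, and by convexity it
  keeps growing at least at this rate.
\<close>

lemma convex_coercive_linear_growth:
  fixes \<psi> :: "'a::real_normed_vector \<Rightarrow> ereal"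
  assumes conv: "ereal_convex \<psi>" and coer: "(\<psi> \<longlongrightarrow> \<infinity>) at_infinity"
    and x0: "\<psi> x0 = ereal a"
  obtains r where "0 < r" "\<And>x. r < norm (x - x0) \<Longrightarrow> ereal (a + norm (x - x0) / r) \<le> \<psi> x"
proof -
  have "\<forall>\<^sub>F x in at_infinity. ereal (a + 1) < \<psi> x"
    using coer by (simp add: order_tendsto_iff)
  then obtain b where b: "\<And>x. b \<le> norm x \<Longrightarrow> ereal (a + 1) < \<psi> x"
    by (auto simp: eventually_at_infinity)
  \<comment> \<open>Points at distance \<open>r\<close> from \<open>x0\<close> have norm at least \<open>b\<close>.\<close>
  define r where "r = max 1 (b + norm x0)"
  have r: "1 \<le> r" "b + norm x0 \<le> r" by (auto simp: r_def)
  show ?thesis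
  proof (rule that[of r])
    fix x assume x: "r < norm (x - x0)"
    \<comment> \<open>Below, \<open>y\<close> is the point where the segment from \<open>x0\<close> to \<open>x\<close> meets the sphere of radius \<open>r\<close>.\<close>
    define s where "s = norm (x - x0)"
    define t where "t = r / s"
    have s: "0 < s" "r < s" using x r by (auto simp: s_def)
    have t: "0 < t" "t < 1" using s r by (auto simp: t_def)
    define y where "y = (1 - t) *\<^sub>R x0 + t *\<^sub>R x"
    have "y - x0 = t *\<^sub>R (x - x0)" by (simp add: y_def algebra_simps)
    then have "norm (y - x0) = r" using s r by (simp add: t_def flip: s_def)
    then have "b \<le> norm y" using norm_triangle_ineq4[of y x0] r by simp
    then have "ereal (a + 1) < \<psi> y" by (rule b)
    also have "\<psi> y \<le> ereal (1 - t) * \<psi> x0 + ereal t * \<psi> x"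
      using conv t unfolding ereal_convex_def y_def by blast
    finally have less: "ereal (a + 1) < ereal (1 - t) * \<psi> x0 + ereal t * \<psi> x" .
    show "ereal (a + norm (x - x0) / r) \<le> \<psi> x"
    proof (cases "\<psi> x")
      case (real q)
      then have "a + 1 < (1 - t) * a + t * q" using less x0 by simp
      then have "1 < t * (q - a)" by (simp add: algebra_simps)
      then have "s / r < q - a" using s r by (simp add: t_def field_simps)
      then show ?thesis using real by (simp add: s_def)
    qed (use less x0 t in auto)
  qed (use r in auto)
qed

text \<open>
  Outside a ball about a point \<open>x0\<close> of finite value this is linear growth of \<open>\<psi>\<close>; inside it,
  semicontinuity bounds \<open>f\<close>. The constant \<open>C\<close> covers both cases and the change of centre from \<open>x0\<close>
  to the origin.
\<close>

lemma log_concave_class_exp_decay: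
  fixes f :: "real ^ 'n \<Rightarrow> real"
  assumes f: "f \<in> log_concave_class"
  obtains C c where "0 \<le> C" "0 < c" "\<And>x. f x \<le> C * exp (- c * norm x)"
proof -
  obtain \<psi> where \<psi>: "\<forall>x. \<psi> x \<noteq> - \<infinity>" "ereal_convex \<psi>" "\<exists>x. \<psi> x \<noteq> \<infinity>"
     "(\<psi> \<longlongrightarrow> \<infinity>) at_infinity" "\<forall>x. f x = exp_neg (\<psi> x)"
    using f unfolding log_concave_class_def by blast
  then obtain x0 a where x0: "\<psi> x0 = ereal a" by (metis ereal_cases)
  obtain r where r: "0 < r" "\<And>x. r < norm (x - x0) \<Longrightarrow> ereal (a + norm (x - x0) / r) \<le> \<psi> x"
    using convex_coercive_linear_growth[OF \<psi>(2,4) x0] by blast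
  obtain M where M: "0 \<le> M" "\<And>x. x \<in> cball x0 r \<Longrightarrow> f x \<le> M"
    using upper_semicont_bdd_above_compact[OF log_concave_class_upper_semicont[OF f], of "cball x0 r"]
    by auto
  define C where "C = max (exp (- a + norm x0 / r)) (M * exp ((r + norm x0) / r))"
  show ?thesis
  proof (rule that[of C "1 / r"])
    show "0 \<le> C" by (simp add: C_def le_max_iff_disj)
    show "0 < 1 / r" using r by simp
    fix x
    show "f x \<le> C * exp (- (1 / r) * norm x)"
    proof (cases "norm (x - x0) \<le> r")
      case True
      then have "norm x \<le> r + norm x0" using norm_triangle_ineq2[of x x0] by simp
      then have "norm x / r \<le> (r + norm x0) / r"
        using r(1) by (intro divide_right_mono) auto
      then have e: "1 \<le> exp ((r + norm x0) / r) * exp (- (1 / r) * norm x)"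
        by (simp flip: exp_add)
      have "f x \<le> M * 1" using M(2)[of x] True by (simp add: dist_norm norm_minus_commute)
      also have "\<dots> \<le> M * (exp ((r + norm x0) / r) * exp (- (1 / r) * norm x))"
        using M(1) e by (rule mult_left_mono[rotated])
      also have "\<dots> \<le> C * exp (- (1 / r) * norm x)"
        unfolding mult.assoc[symmetric] by (intro mult_right_mono) (auto simp: C_def)
      finally show ?thesis .
    next
      case False
      then have g: "ereal (a + norm (x - x0) / r) \<le> \<psi> x" using r by auto
      have "norm x / r \<le> norm (x - x0) / r + norm x0 / r"
        using r norm_triangle_ineq2[of x x0] by (simp add: field_simps)
      then have "exp_neg (\<psi> x) \<le> exp (- a + norm x0 / r) * exp (- (1 / r) * norm x)"
        using g by (cases "\<psi> x") (auto simp: exp_neg_def simp flip: exp_add)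
      also have "\<dots> \<le> C * exp (- (1 / r) * norm x)"
        by (intro mult_right_mono) (auto simp: C_def)
      finally show ?thesis using \<psi>(5) by simp
    qed
  qed
qed

section \<open>Affine maps escaping to infinity\<close>

text \<open>
  The functional in the parameters \<open>S = T\<inverse>\<close> and \<open>w = T\<inverse> z\<close>. All pairs \<open>(S, w)\<close> are admitted, not
  only those with \<open>det S = 1\<close>, so that directions at infinity can be normalised in a vector space.
\<close>

definition overlap :: "(real ^ 'n \<Rightarrow> real) \<Rightarrow> (real ^ 'n \<Rightarrow> real) \<Rightarrow> (real ^ 'n ^ 'n) \<times> (real ^ 'n) \<Rightarrow> ennreal"
  where "overlap f g p = (\<integral>\<^sup>+ x. ennreal (f x * g (fst p *v x - snd p)) \<partial>lborel)"

lemma continuous_matrix_vector_mult [continuous_intros]: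
  fixes A :: "'a::topological_space \<Rightarrow> real ^ 'n ^ 'm"
  shows "continuous_on U A \<Longrightarrow> continuous_on U v \<Longrightarrow> continuous_on U (\<lambda>a. A a *v v a)"
  unfolding matrix_vector_mult_def by (intro continuous_intros)

lemma tendsto_affine:
  fixes u :: "nat \<Rightarrow> (real ^ 'n ^ 'm) \<times> (real ^ 'm)"
  assumes "u \<longlonglongrightarrow> p"
  shows "(\<lambda>k. fst (u k) *v x - snd (u k)) \<longlonglongrightarrow> fst p *v x - snd p"
proof -
  have "continuous_on UNIV (\<lambda>p::(real ^ 'n ^ 'm) \<times> (real ^ 'm). fst p *v x - snd p)"
    by (intro continuous_intros)
  then show ?thesis
    using assms by (auto simp: continuous_on_eq_continuous_at continuous_at_sequentially o_def)
qed

text \<open>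
  A nonzero pair \<open>p\<close> has some component \<open>i\<close> for which the scalar equation \<open>S\<^sub>i \<bullet> x = w\<^sub>i\<close> is
  nontrivial. Its solution set is a hyperplane or, if \<open>S\<^sub>i = 0\<close>, empty.
\<close>

lemma AE_affine_nonzero:
  fixes p :: "(real ^ 'n ^ 'm) \<times> (real ^ 'm)"
  assumes "p \<noteq> 0"
  shows "AE x in lborel. fst p *v x - snd p \<noteq> 0"
proof -
  obtain i where i: "fst p $ i \<noteq> 0 \<or> snd p $ i \<noteq> 0"
    using assms by (auto simp: prod_eq_iff vec_eq_iff)
  let ?H = "{x. fst p $ i \<bullet> x = snd p $ i}"
  have "?H \<in> null_sets lebesgue"
    using negligible_hyperplane[OF i] by (simp add: negligible_iff_null_sets)
  then have "?H \<in> null_sets lborel"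
    using closed_hyperplane[of "fst p $ i" "snd p $ i"] by (subst (asm) null_sets_completion_iff) auto
  then show ?thesis
  proof (rule AE_I')
    show "{x \<in> space lborel. \<not> fst p *v x - snd p \<noteq> 0} \<subseteq> ?H"
      by (auto simp: vec_eq_iff matrix_vector_mul_component)
  qed
qed

section \<open>Semicontinuity, decay at infinity and existence of a maximum\<close>

text \<open>
  The properties of the two functions on which the existence of a maximum rests. They are not
  symmetric: \<open>f\<close> provides the integrable majorant \<open>M f\<close>, while \<open>g\<close> provides semicontinuity and
  decay at infinity.
\<close>

locale overlap_pair =
  fixes f g :: "real ^ 'n \<Rightarrow> real" and M :: real
  assumes f_nonneg: "\<And>x. 0 \<le> f x" and g_nonneg: "\<And>x. 0 \<le> g x"
    and f_measurable: "f \<in> borel_measurable borel"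
    and f_integrable: "(\<integral>\<^sup>+ x. ennreal (f x) \<partial>lborel) < \<infinity>"
    and g_upper_semicont: "upper_semicont g"
    and g_le: "\<And>x. g x \<le> M"
    and g_vanishes: "(g \<longlongrightarrow> 0) at_infinity"
begin

lemma M_nonneg: "0 \<le> M" using g_le[of 0] g_nonneg[of 0] by simp

lemma overlap_integrand_measurable [measurable]:
  "(\<lambda>x. ennreal (f x * g (fst p *v x - snd p))) \<in> borel_measurable lborel"
proof -
  have [measurable]: "f \<in> borel_measurable borel" "g \<in> borel_measurable borel"
    by (fact f_measurable, fact upper_semicont_borel_measurable[OF g_upper_semicont])
  have [measurable]: "(\<lambda>x. fst p *v x - snd p) \<in> borel_measurable borel"
    by (intro borel_measurable_continuous_onI continuous_intros)
  show ?thesis by measurable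
qed

lemma overlap_majorant:
  "(\<lambda>x. ennreal (f x * M)) \<in> borel_measurable lborel"
  "ennreal (f x * g y) \<le> ennreal (f x * M)"
  "(\<integral>\<^sup>+ x. ennreal (f x * M) \<partial>lborel) < \<infinity>"
proof -
  have [measurable]: "f \<in> borel_measurable borel" by (fact f_measurable)
  show "(\<lambda>x. ennreal (f x * M)) \<in> borel_measurable lborel" by measurable
  show "ennreal (f x * g y) \<le> ennreal (f x * M)"
    by (intro ennreal_leI mult_left_mono g_le f_nonneg)
  have "(\<integral>\<^sup>+ x. ennreal (f x * M) \<partial>lborel) = (\<integral>\<^sup>+ x. ennreal (f x) \<partial>lborel) * ennreal M"
    by (simp add: ennreal_mult f_nonneg M_nonneg nn_integral_multc)
  also have "\<dots> < \<infinity>" using f_integrable by (simp add: ennreal_mult_less_top)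
  finally show "(\<integral>\<^sup>+ x. ennreal (f x * M) \<partial>lborel) < \<infinity>" .
qed

text \<open>Reverse Fatou with majorant \<open>M f\<close>, followed by upper semicontinuity of \<open>g\<close> at each point.\<close>

lemma limsup_overlap_le:
  assumes "u \<longlonglongrightarrow> p"
  shows "limsup (\<lambda>k. overlap f g (u k)) \<le> overlap f g p"
proof -
  have "limsup (\<lambda>k. overlap f g (u k))
      \<le> (\<integral>\<^sup>+ x. limsup (\<lambda>k. ennreal (f x * g (fst (u k) *v x - snd (u k)))) \<partial>lborel)"
    unfolding overlap_def
    by (rule nn_integral_limsup[OF _ overlap_majorant(1) _ overlap_majorant(3)])
      (auto intro: overlap_majorant(2))
  also have "\<dots> \<le> overlap f g p"
    unfolding overlap_def
    by (intro nn_integral_mono upper_semicont_limsup g_upper_semicont tendsto_affine assms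
        f_nonneg g_nonneg)
  finally show ?thesis .
qed

text \<open>
  Since \<open>(S, w) \<mapsto> S x - w\<close> is linear, its value at \<open>u k\<close> is \<open>norm (u k)\<close> times its value at the
  normalised pair. The latter converges to a nonzero vector for almost every \<open>x\<close>, so the product
  goes to infinity, where \<open>g\<close> vanishes; dominated convergence concludes.
\<close>

lemma overlap_tendsto_0_along_direction:
  assumes norm: "filterlim (\<lambda>k. norm (u k)) at_top sequentially"
    and dir: "(\<lambda>k. sgn (u k)) \<longlonglongrightarrow> d" and d: "d \<noteq> 0"
  shows "(\<lambda>k. overlap f g (u k)) \<longlonglongrightarrow> 0"
proof -
  have "(\<lambda>k. \<integral>\<^sup>+ x. ennreal (f x * g (fst (u k) *v x - snd (u k))) \<partial>lborel)
      \<longlonglongrightarrow> (\<integral>\<^sup>+ x. 0 \<partial>(lborel :: (real ^ 'n) measure))"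
  proof (rule nn_integral_dominated_convergence[where w = "\<lambda>x. ennreal (f x * M)"])
    show "AE x in lborel. (\<lambda>k. ennreal (f x * g (fst (u k) *v x - snd (u k)))) \<longlonglongrightarrow> 0"
      using AE_affine_nonzero[OF d]
    proof eventually_elim
      case (elim x)
      let ?L = "\<lambda>p::(real ^ 'n ^ 'n) \<times> (real ^ 'n). fst p *v x - snd p"
      have L: "norm (?L (u k)) = norm (?L (sgn (u k))) * norm (u k)" for k
      proof -
        have "u k = norm (u k) *\<^sub>R sgn (u k)" by (cases "u k = 0") (simp_all add: sgn_div_norm)
        then have "?L (u k) = ?L (norm (u k) *\<^sub>R sgn (u k))" by simp
        also have "\<dots> = norm (u k) *\<^sub>R ?L (sgn (u k))"
          by (simp only: fst_scaleR snd_scaleR scaleR_matrix_vector_assoc scaleR_diff_right)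
        finally show ?thesis by simp
      qed
      have "(\<lambda>k. norm (?L (sgn (u k)))) \<longlonglongrightarrow> norm (?L d)"
        by (intro tendsto_norm tendsto_affine dir)
      then have "filterlim (\<lambda>k. norm (?L (u k))) at_top sequentially"
        unfolding L using elim norm by (intro filterlim_tendsto_pos_mult_at_top) auto
      then have "filterlim (\<lambda>k. ?L (u k)) at_infinity sequentially"
        by (rule filterlim_norm_at_top_imp_at_infinity)
      then have "(\<lambda>k. g (?L (u k))) \<longlonglongrightarrow> 0"
        by (rule filterlim_compose[OF g_vanishes])
      then have "(\<lambda>k. ennreal (f x * g (?L (u k)))) \<longlonglongrightarrow> ennreal (f x * 0)"
        by (intro tendsto_intros)
      then show ?case by simp
    qed
  qed (use overlap_majorant in auto)
  then show ?thesis by (simp add: overlap_def)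
qed

text \<open>
  Otherwise the overlap stays above some \<open>e > 0\<close> along a sequence going to infinity. Compactness of
  the unit ball gives a subsequence with convergent directions, along which the overlap
  would have to tend to \<open>0\<close>.
\<close>

lemma overlap_vanishes_at_infinity: "(overlap f g \<longlongrightarrow> 0) at_infinity"
proof (rule ccontr)
  assume "\<not> ?thesis"
  then obtain e where e: "0 < e" and "\<not> (\<forall>\<^sub>F p in at_infinity. overlap f g p < e)"
    by (auto simp: order_tendsto_iff)
  then have "\<forall>k::nat. \<exists>p. real k \<le> norm p \<and> e \<le> overlap f g p"
    by (auto simp: eventually_at_infinity not_less)
  then obtain u where u: "\<And>k. real k \<le> norm (u k)" "\<And>k. e \<le> overlap f g (u k)"
    by metis
  have at_top: "filterlim (\<lambda>k. norm (u k)) at_top sequentially"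
    by (rule filterlim_at_top_mono[OF filterlim_real_sequentially]) (simp add: u)
  have "bounded (range (\<lambda>k. sgn (u k)))"
    by (rule boundedI[of _ 1]) (auto simp: norm_sgn)
  then obtain d r where r: "strict_mono r" and d: "((\<lambda>k. sgn (u k)) \<circ> r) \<longlonglongrightarrow> d"
    using bounded_imp_convergent_subsequence by blast
  have at_top': "filterlim (\<lambda>k. norm (u (r k))) at_top sequentially"
    by (rule filterlim_compose[OF at_top filterlim_subseq[OF r]])
  \<comment> \<open>As \<open>sgn 0 = 0\<close>, the limit direction is a unit vector only because \<open>u\<close> is eventually nonzero.\<close>
  have "\<forall>\<^sub>F k in sequentially. 0 < norm (u (r k))"
    using at_top' unfolding filterlim_at_top_dense by blast
  then have "\<forall>\<^sub>F k in sequentially. norm (sgn (u (r k))) = 1"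
    by eventually_elim (auto simp: norm_sgn)
  moreover have "(\<lambda>k. norm (sgn (u (r k)))) \<longlonglongrightarrow> norm d"
    using d by (auto simp: o_def intro: tendsto_norm)
  ultimately have "norm d = 1"
    using LIMSEQ_unique[OF _ tendsto_eventually] by blast
  then have "(\<lambda>k. overlap f g (u (r k))) \<longlonglongrightarrow> 0"
    using d by (intro overlap_tendsto_0_along_direction[OF at_top']) (auto simp: o_def)
  then have "e \<le> 0"
    by (rule LIMSEQ_le_const) (use u in auto)
  then show False using e by simp
qed

text \<open>
  The direct method: if the supremum is positive, a maximizing sequence eventually stays in the bounded
  region where the overlap is not small, so it has a limit point in the closed set \<open>D\<close>, and upper
  semicontinuity makes this point a maximizer.
\<close>

lemma overlap_attains_sup:
  assumes "closed D" "D \<noteq> {}"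
  shows "\<exists>p\<in>D. overlap f g p = (SUP q\<in>D. overlap f g q)"
proof (cases "(SUP q\<in>D. overlap f g q) = 0")
  case True
  then show ?thesis using assms(2) by (auto simp: SUP_eq_iff bot_ennreal)
next
  case False
  let ?s = "SUP q\<in>D. overlap f g q"
  obtain F where F: "incseq F" "range F \<subseteq> overlap f g ` D" "?s = (SUP i::nat. F i)"
    using ennreal_Sup_countable_SUP[of "overlap f g ` D"] assms(2) by auto
  then have "\<forall>k. \<exists>p\<in>D. F k = overlap f g p" by auto
  then obtain u where u: "\<And>k. u k \<in> D" "\<And>k. F k = overlap f g (u k)" by metis
  have lim: "(\<lambda>k. overlap f g (u k)) \<longlonglongrightarrow> ?s"
    using LIMSEQ_SUP[OF F(1)] unfolding F(3) u(2)[symmetric] .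
  obtain e where e: "0 < e" "e < ?s"
    using False dense[of 0 ?s] by (auto simp: zero_less_iff_neq_zero)
  obtain b where b: "\<And>p. b \<le> norm p \<Longrightarrow> overlap f g p < e"
    using order_tendstoD(2)[OF overlap_vanishes_at_infinity e(1)]
    unfolding eventually_at_infinity by blast
  obtain N where N: "\<And>k. N \<le> k \<Longrightarrow> e < overlap f g (u k)"
    using order_tendstoD(1)[OF lim e(2)] unfolding eventually_sequentially by blast
  have "norm (u (k + N)) \<le> b" for k
    using b[of "u (k + N)"] N[of "k + N"] by (meson le_add2 linear not_less_iff_gr_or_eq)
  then have "bounded (range (\<lambda>k. u (k + N)))" by (intro boundedI) auto
  then obtain p r where r: "strict_mono r" and p: "((\<lambda>k. u (k + N)) \<circ> r) \<longlonglongrightarrow> p"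
    using bounded_imp_convergent_subsequence by blast
  have "p \<in> D"
    using closed_sequentially[OF assms(1) _ p] u by auto
  have "((\<lambda>k. overlap f g (u (k + N))) \<circ> r) \<longlonglongrightarrow> ?s"
    by (intro LIMSEQ_subseq_LIMSEQ r LIMSEQ_ignore_initial_segment lim)
  then have "?s = limsup (\<lambda>k. overlap f g (((\<lambda>k. u (k + N)) \<circ> r) k))"
    by (intro lim_imp_Limsup[symmetric]) (auto simp: o_def)
  also have "\<dots> \<le> overlap f g p" by (rule limsup_overlap_le[OF p])
  finally show ?thesis using \<open>p \<in> D\<close> by (auto intro!: bexI[of _ p] antisym SUP_upper)
qed

end

lemma log_concave_class_overlap_pair:
  fixes f g :: "real ^ 'n \<Rightarrow> real"
  assumes f: "f \<in> log_concave_class" and g: "g \<in> log_concave_class"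
  obtains M where "overlap_pair f g M"
proof -
  obtain C c where C: "0 \<le> C" "0 < c" "\<And>x. f x \<le> C * exp (- c * norm x)"
    using log_concave_class_exp_decay[OF f] by blast
  obtain M k where M: "0 \<le> M" "0 < k" "\<And>x. g x \<le> M * exp (- k * norm x)"
    using log_concave_class_exp_decay[OF g] by blast
  have "overlap_pair f g M"
  proof
    have "(\<integral>\<^sup>+ x. ennreal (f x) \<partial>lborel)
        \<le> (\<integral>\<^sup>+ x. ennreal C * ennreal (exp (- c * norm x)) \<partial>(lborel :: (real^'n) measure))"
      using C by (intro nn_integral_mono) (simp add: ennreal_leI flip: ennreal_mult)
    also have "\<dots> = ennreal C * (\<integral>\<^sup>+ x. ennreal (exp (- c * norm x)) \<partial>(lborel :: (real^'n) measure))"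
      by (intro nn_integral_cmult) auto
    also have "\<dots> < \<infinity>"
      using nn_integral_exp_neg_norm_finite[OF C(2), where 'a = "real ^ 'n"]
      by (simp add: ennreal_mult_less_top)
    finally show "(\<integral>\<^sup>+ x. ennreal (f x) \<partial>lborel) < \<infinity>" .
    show "g x \<le> M" for x
    proof -
      have "M * exp (- k * norm x) \<le> M * 1" using M by (intro mult_left_mono) auto
      then show ?thesis using M(3)[of x] by simp
    qed
    have "filterlim (\<lambda>x::real^'n. - k * norm x) at_bot at_infinity"
      using M(2) filterlim_norm_at_top
      by (intro filterlim_tendsto_neg_mult_at_bot[OF tendsto_const]) auto
    then have "((\<lambda>x::real^'n. exp (- k * norm x)) \<longlongrightarrow> 0) at_infinity"
      by (rule filterlim_compose[OF exp_at_bot])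
    then have "((\<lambda>x::real^'n. M * exp (- k * norm x)) \<longlongrightarrow> 0) at_infinity"
      by (rule tendsto_mult_right_zero)
    then show "(g \<longlongrightarrow> 0) at_infinity"
      by (rule tendsto_sandwich[OF _ _ tendsto_const, rotated 2])
        (use M(3) in \<open>auto simp: log_concave_class_nonneg[OF g]\<close>)
  qed (use f g log_concave_class_nonneg log_concave_class_upper_semicont
      upper_semicont_borel_measurable in \<open>blast+\<close>)
  then show ?thesis by (rule that)
qed

section \<open>Reparametrization of the special linear group\<close>

lemma closed_SL: "closed (SL :: (real ^ 'n ^ 'n) set)"
proof -
  have "continuous_on UNIV (det :: real ^ 'n ^ 'n \<Rightarrow> real)"
    unfolding det_def by (intro continuous_intros)
  from continuous_closed_preimage_constant[OF this, of 1] show ?thesis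
    by (simp add: SL_def)
qed

lemma SL_matrix_inv:
  fixes T :: "real ^ 'n ^ 'n"
  assumes "T \<in> SL"
  shows "T ** matrix_inv T = mat 1" "matrix_inv T \<in> SL"
proof -
  have d: "det T = 1" using assms by (simp add: SL_def)
  then have "\<exists>S. T ** S = mat 1 \<and> S ** T = mat 1"
    using invertible_det_nz[of T] by (simp add: invertible_def)
  then have "T ** matrix_inv T = mat 1 \<and> matrix_inv T ** T = mat 1"
    unfolding matrix_inv_def by (rule someI_ex)
  then show 1: "T ** matrix_inv T = mat 1" ..
  have "det T * det (matrix_inv T) = 1" using 1 by (metis det_I det_mul)
  then show "matrix_inv T \<in> SL" using d by (simp add: SL_def)
qed

lemma matrix_inv_matrix_inv_SL:
  fixes T :: "real ^ 'n ^ 'n"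
  assumes "T \<in> SL"
  shows "matrix_inv (matrix_inv T) = T"
proof -
  have "matrix_inv (matrix_inv T) = (T ** matrix_inv T) ** matrix_inv (matrix_inv T)"
    by (simp add: SL_matrix_inv(1)[OF assms])
  also have "\<dots> = T ** (matrix_inv T ** matrix_inv (matrix_inv T))"
    by (simp only: matrix_mul_assoc)
  also have "\<dots> = T"
    by (simp add: SL_matrix_inv(1)[OF SL_matrix_inv(2)[OF assms]])
  finally show ?thesis .
qed

text \<open>Because \<open>T\<inverse> (x - z) = T\<inverse> x - T\<inverse> z\<close>.\<close>

lemma P_eq_overlap: "P f g T z = overlap f g (matrix_inv T, matrix_inv T *v z)"
  by (simp add: P_def overlap_def matrix_vector_mult_diff_distrib)

text \<open>
  The substitution \<open>(T, z) \<mapsto> (T\<inverse>, T\<inverse> z)\<close> is its own inverse on \<open>SL \<times> UNIV\<close>, so both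
  parametrizations have the same supremum.
\<close>

lemma image_matrix_inv_SL:
  "(\<lambda>(T, z). (matrix_inv T, matrix_inv T *v z)) ` (SL \<times> UNIV) = SL \<times> (UNIV :: (real ^ 'n) set)"
    (is "?h ` ?D = ?D")
proof
  show "?h ` ?D \<subseteq> ?D" by (auto simp: SL_matrix_inv)
  show "?D \<subseteq> ?h ` ?D"
  proof
    fix p assume "p \<in> ?D"
    then obtain S w where p: "p = (S, w)" "S \<in> SL" by auto
    then have "p = ?h (matrix_inv S, matrix_inv S *v w)"
      by (simp add: SL_matrix_inv matrix_inv_matrix_inv_SL matrix_vector_mul_assoc)
    then show "p \<in> ?h ` ?D" using p SL_matrix_inv by blast
  qed
qed

theorem theorem6:
  fixes f g :: "real ^ 'n \<Rightarrow> real"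
  assumes "f \<in> log_concave_class" and "g \<in> log_concave_class"
  shows "\<exists>(T0, z0) \<in> SL \<times> UNIV. P f g T0 z0 = (SUP (T, z) \<in> SL \<times> UNIV. P f g T z)"
proof -
  let ?D = "SL \<times> UNIV :: ((real ^ 'n ^ 'n) \<times> (real ^ 'n)) set"
  let ?h = "\<lambda>(T, z). (matrix_inv T, matrix_inv T *v z :: real ^ 'n)"
  obtain M where "overlap_pair f g M" using log_concave_class_overlap_pair[OF assms] .
  then interpret overlap_pair f g M .
  have P: "(\<lambda>(T, z). P f g T z) = overlap f g \<circ> ?h"
    by (auto simp: P_eq_overlap)
  have "mat 1 \<in> (SL :: (real ^ 'n ^ 'n) set)" by (simp add: SL_def)
  then have "\<exists>p\<in>?D. overlap f g p = (SUP q\<in>?D. overlap f g q)"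
    by (intro overlap_attains_sup closed_Times closed_SL closed_UNIV) auto
  also have "?D = ?h ` ?D" using image_matrix_inv_SL ..
  finally have "\<exists>p\<in>?D. (overlap f g \<circ> ?h) p = (SUP q\<in>?D. (overlap f g \<circ> ?h) q)"
    by (simp only: image_image o_def bex_simps)
  then show ?thesis
    unfolding P[symmetric] by auto
qed

end
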